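(* Let $\lambda\in(0,1)$ and $x>y>0$. Then for every $z\in\mathbb{C}\setminus(-\infty,-y]$, the principal branch of the weighted geometric mean $G_{x,y;\lambda}(z)=(x+z)^{\lambda}(y+z)^{1-\lambda}$ has the integral representation $$G_{x,y;\lambda}(z)=x^{\lambda}y^{1-\lambda}+z+\frac{\sin(\lambda\pi)}{\pi}(x-y)\int_0^\infty\frac{F(\lambda,(x-y)s)}{s}\,e^{-sy}\bigl(1-e^{-sz}\bigr)\,ds,$$ where, for $s>0$, $$F(\lambda,s)=\int_0^1\Bigl(\frac1u-1\Bigr)^{\lambda}\Bigl(1-\frac{\lambda}{1-u}\Bigr)e^{-us}\,du>0.$$ Consequently, for all $\lambda\in(0,1)$ and $x,y>0$, the function $t\mapsto G_{x,y;\lambda}(t)$ is a Bernstein function of $t>-\min\{x,y\}$.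
   Context: Complex powers are principal: $w^{\beta}=\exp(\beta\operatorname{Log}w)$ for $w\in\mathbb{C}\setminus(-\infty,0]$, with $\operatorname{Log}$ the principal logarithm; the principal branch of $G_{x,y;\lambda}(z)$ is the product of the principal powers $(x+z)^{\lambda}$ and $(y+z)^{1-\lambda}$. A function $f$ is completely monotonic on an interval $I$ if it has derivatives of all orders on $I$ and $(-1)^n f^{(n)}(t)\ge 0$ for all $t\in I$ and all integers $n\ge 0$. A function $f:I\to[0,\infty)$ on an interval $I\subseteq(-\infty,\infty)$ is a Bernstein function on $I$ if it has derivatives of all orders on $I$ and $f'$ is completely monotonic on $I$.
   Formalization: The integral diverges when Re z < -y, so the representation is asserted at those z in C\(-∞,-y] where the integral exists absolutely, proved to include every z with Re z ≥ -y; G is moreover shown holomorphic on all of C\(-∞,-y]. *)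

theory Defs
  imports "HOL-Analysis.Analysis"
begin

text \<open>
  The type \<open>'a\<close> is \<open>real\<close> or \<open>complex\<close>. On \<open>complex\<close>, \<open>w powr b = exp (b * Ln w)\<close> for \<open>w \<noteq> 0\<close>,
  with the principal logarithm \<open>Ln\<close>; so on \<open>z \<notin> of_real ` {.. - min x y}\<close> this is the product of
  the principal powers.
\<close>
definition wgm :: "real \<Rightarrow> real \<Rightarrow> real \<Rightarrow> 'a::{ln, real_normed_algebra_1} \<Rightarrow> 'a" where
  "wgm x y l z = (of_real x + z) powr of_real l * (of_real y + z) powr of_real (1 - l)"

definition F_integrand :: "real \<Rightarrow> real \<Rightarrow> real \<Rightarrow> real" where
  "F_integrand l s u = (1 / u - 1) powr l * (1 - l / (1 - u)) * exp (- (u * s))"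

definition F :: "real \<Rightarrow> real \<Rightarrow> real" where
  "F l s = (LBINT u:{0<..<1}. F_integrand l s u)"

text \<open>
  For fixed \<open>0 < y < x\<close>, this is integrable over \<open>{0<..}\<close> if and only if \<open>- y \<le> Re z\<close>: for
  \<open>Re z < - y\<close> it grows exponentially, because \<open>F l s\<close> only decays like \<open>s powr (l - 1)\<close>.
\<close>
definition wgm_integrand :: "real \<Rightarrow> real \<Rightarrow> real \<Rightarrow> complex \<Rightarrow> real \<Rightarrow> complex" where
  "wgm_integrand x y l z s =
     of_real (F l ((x - y) * s) / s * exp (- (s * y))) * (1 - exp (- (of_real s * z)))"

text \<open>
  \<open>D n\<close> is the \<open>n\<close>-th derivative of \<open>f\<close> on \<open>I\<close>, one-sided at endpoints belonging to \<open>I\<close>. The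
  derivatives are determined by \<open>f\<close> when the interval \<open>I\<close> is not a single point, which is
  the intended use.
\<close>
definition derivatives_on :: "real set \<Rightarrow> (real \<Rightarrow> real) \<Rightarrow> (nat \<Rightarrow> real \<Rightarrow> real) \<Rightarrow> bool" where
  "derivatives_on I f D \<longleftrightarrow>
     (\<forall>t\<in>I. D 0 t = f t) \<and>
     (\<forall>n. \<forall>t\<in>I. (D n has_real_derivative D (Suc n) t) (at t within I))"

definition completely_monotonic_on :: "real set \<Rightarrow> (real \<Rightarrow> real) \<Rightarrow> bool" where
  "completely_monotonic_on I f \<longleftrightarrow>
     (\<exists>D. derivatives_on I f D \<and> (\<forall>n. \<forall>t\<in>I. 0 \<le> (- 1) ^ n * D n t))"

definition bernstein_function_on :: "real set \<Rightarrow> (real \<Rightarrow> real) \<Rightarrow> bool" where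
  "bernstein_function_on I f \<longleftrightarrow>
     (\<forall>t\<in>I. 0 \<le> f t) \<and>
     (\<exists>D. derivatives_on I f D \<and> completely_monotonic_on I (D 1))"

end

theory Submission
  imports Defs "HOL-Complex_Analysis.Complex_Analysis"
begin

text \<open>
  Put \<open>a = x - y\<close> and \<open>w = y + z\<close>. The function \<open>(w + a)\<^sup>l w\<^sup>1\<^sup>-\<^sup>l\<close> is holomorphic off the cut
  \<open>[- a, 0]\<close>, and its jump there has the density \<open>v\<^sup>1\<^sup>-\<^sup>l (1 - v)\<^sup>l\<close> (up to scaling), which leads to the
  Stieltjes representation
  \<open>(w + a)\<^sup>l w\<^sup>1\<^sup>-\<^sup>l = w + l a - sin (l \<pi>) / \<pi> a\<^sup>2 \<integral>\<^sub>0\<^sup>1 v\<^sup>1\<^sup>-\<^sup>l (1 - v)\<^sup>l / (a v + w) dv\<close>.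
  Instead of by contour integration it is obtained for real \<open>w > a\<close> by comparing the binomial series
  with the geometric series of the kernel (Beta integrals), and then by analytic continuation.
  Integration by parts turns \<open>F l s\<close> into \<open>s\<close> times the Laplace transform of the density, and
  \<open>1 / (a v + w) = \<integral>\<^sub>0\<^sup>\<infinity> exp (- s (a v + w)) ds\<close> with Fubini gives the claimed integral. For
  \<open>Re z < - y\<close> that integral does not exist, since the Laplace transform of the density decays
  more slowly than any exponential. Differentiating the Stieltjes representation under the integral
  sign yields the signs of the derivatives.
\<close>

subsection \<open>The weight and its transforms\<close>

definition wt :: "real \<Rightarrow> real \<Rightarrow> real" where
  "wt l v = v powr (1 - l) * (1 - v) powr l"

definition wt_laplace :: "real \<Rightarrow> real \<Rightarrow> real" where
  "wt_laplace l s = integral {0..1} (\<lambda>v. wt l v * exp (- (v * s)))"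

text \<open>The exponent \<open>n\<close> closes the family under differentiation. The type stays
  open because the signs of derivatives are read off over the reals while the continuation runs over
  the complex numbers.\<close>

definition wt_stieltjes :: "real \<Rightarrow> real \<Rightarrow> nat \<Rightarrow> 'a::{real_normed_field, euclidean_space} \<Rightarrow> 'a" where
  "wt_stieltjes l a n w = integral {0..1} (\<lambda>v. of_real (wt l v) / (of_real (a * v) + w) ^ n)"

section \<open>The weight and the derivatives of its Stieltjes transform\<close>

lemma wt_nonneg: "0 \<le> wt l v"
  by (simp add: wt_def)

lemma wt_pos: "0 < v \<Longrightarrow> v < 1 \<Longrightarrow> 0 < wt l v"
  by (simp add: wt_def)

lemma continuous_on_wt:
  assumes "0 < l" "l < 1"
  shows "continuous_on {0..1} (wt l)"
  unfolding wt_def using assms by (intro continuous_on_mult continuous_on_powr' continuous_intros) auto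

lemma wt_borel [measurable]: "wt l \<in> borel_measurable borel"
  unfolding wt_def by measurable

lemma DERIV_divide_power_shift:
  fixes b :: "'a::real_normed_field"
  assumes "b + x \<noteq> 0"
  shows "((\<lambda>x. c / (b + x) ^ n) has_field_derivative - of_nat n * (c / (b + x) ^ Suc n)) (at x within S)"
proof (cases n)
  case (Suc m)
  have P: "((\<lambda>x. (b + x) ^ n) has_field_derivative of_nat n * (b + x) ^ m) (at x within S)"
    by (rule derivative_eq_intros refl)+ (simp add: Suc)
  have "((\<lambda>x. c / (b + x) ^ n) has_field_derivative
      - (c * (of_nat n * (b + x) ^ m)) / ((b + x) ^ n * (b + x) ^ n)) (at x within S)"
    by (rule derivative_eq_intros P refl)+ (use assms in auto)
  also have "- (c * (of_nat n * (b + x) ^ m)) / ((b + x) ^ n * (b + x) ^ n) = - of_nat n * (c / (b + x) ^ Suc n)"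
  proof -
    have "w \<noteq> 0 \<Longrightarrow> - (c * (k * w ^ m)) / (w ^ Suc m * w ^ Suc m) = - k * (c / w ^ Suc (Suc m))" for w k :: 'a
      by (simp add: field_simps)
    from this[OF assms] show ?thesis unfolding Suc .
  qed
  finally show ?thesis .
qed simp

text \<open>Differentiation under the integral sign, the integrand being jointly continuous where no
  denominator vanishes. The open set is a parameter so that one proof serves real derivatives on a
  half-line and holomorphy on the slit plane.\<close>

lemma wt_stieltjes_has_field_derivative:
  fixes U :: "'a::{real_normed_field, euclidean_space} set"
  assumes l: "0 < l" "l < 1" and U: "open U" "w \<in> U"
    and nz: "\<And>w v. w \<in> U \<Longrightarrow> v \<in> {0..1} \<Longrightarrow> of_real (a * v) + w \<noteq> 0"
  shows "(wt_stieltjes l a n has_field_derivative - of_nat n * wt_stieltjes l a (Suc n) w) (at w)"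
proof -
  \<comment> \<open>The Leibniz rule wants a convex domain, which \<open>U\<close> need not be; a
    ball around \<open>w\<close> suffices.\<close>
  obtain r where r: "r > 0" "ball w r \<subseteq> U"
    using U open_contains_ball by blast
  have wr: "w \<in> ball w r" using r by simp
  have nz': "of_real (a * v) + x \<noteq> 0" if "x \<in> ball w r" "v \<in> {0..1}" for x v
    using nz that r by blast
  have c: "continuous_on (ball w r \<times> {0..1}) (\<lambda>p. wt l (snd p))"
    by (rule continuous_on_compose2[OF continuous_on_wt[OF l]]) (auto intro!: continuous_intros)
  have "((\<lambda>x. integral (cbox 0 1) (\<lambda>v. of_real (wt l v) / (of_real (a * v) + x) ^ n))
      has_field_derivative integral (cbox 0 1)
        (\<lambda>v. - of_nat n * (of_real (wt l v) / (of_real (a * v) + w) ^ Suc n))) (at w within ball w r)"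
  proof (rule leibniz_rule_field_derivative)
    fix x :: 'a and t :: real assume x: "x \<in> ball w r" "t \<in> cbox 0 1"
    then have "of_real (a * t) + x \<noteq> 0" using nz'[of x t] by auto
    then show "((\<lambda>x. of_real (wt l t) / (of_real (a * t) + x) ^ n) has_field_derivative
       - of_nat n * (of_real (wt l t) / (of_real (a * t) + x) ^ Suc n)) (at x within ball w r)"
      by (rule DERIV_divide_power_shift)
  next
    fix x assume x: "x \<in> ball w r"
    show "(\<lambda>v. of_real (wt l v) / (of_real (a * v) + x) ^ n) integrable_on cbox 0 1"
      using nz'[OF x] by (intro integrable_continuous continuous_intros) (auto intro!: continuous_on_wt l)
  next
    show "continuous_on (ball w r \<times> cbox 0 1)
      (\<lambda>(x, t). - of_nat n * (of_real (wt l t) / (of_real (a * t) + x) ^ Suc n))"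
      unfolding case_prod_unfold
      by (intro continuous_intros) (use nz' c in \<open>auto simp del: of_real_mult power_Suc\<close>)
  qed (use r in auto)
  moreover have "integral (cbox 0 1) (\<lambda>v. - of_nat n * (of_real (wt l v) / (of_real (a * v) + w) ^ Suc n))
      = - of_nat n * wt_stieltjes l a (Suc n) w"
    unfolding wt_stieltjes_def cbox_interval by (rule integral_mult_right)
  moreover have "wt_stieltjes l a n = (\<lambda>x::'a. integral (cbox 0 1) (\<lambda>v. of_real (wt l v) / (of_real (a * v) + x) ^ n))"
    by (simp add: wt_stieltjes_def[abs_def])
  ultimately show ?thesis
    by (simp only: at_within_open[OF wr open_ball])
qed

section \<open>\<open>F\<close> as a Laplace transform\<close>

text \<open>Absorbing \<open>1 / (1 - u)\<close> into the power of \<open>1 - u\<close> exposes two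
  Beta densities, the form needed both for a majorant and for comparison with the derivative of
  \<open>wt l\<close>.\<close>

lemma F_integrand_eq:
  assumes "0 < u" "u < 1"
  shows "F_integrand l s u =
    (u powr (- l) * (1 - u) powr l - l * (u powr (- l) * (1 - u) powr (l - 1))) * exp (- (u * s))"
proof -
  have "1 / u - 1 = (1 - u) / u" using assms by (simp add: field_simps)
  then show ?thesis using assms
    by (simp add: F_integrand_def powr_divide powr_minus powr_diff field_simps)
qed

text \<open>The exponential is at most 1, so the sum of the two Beta densities dominates; its
  exponents all exceed \<open>- 1\<close>.\<close>

lemma set_integrable_F_integrand:
  assumes "0 < l" "l < 1" "0 < s"
  shows "set_integrable lborel {0<..<1} (F_integrand l s)"
proof -
  have B: "set_integrable lborel {0<..<1} (\<lambda>t. t powr (-l) * (1 - t) powr b)" if "b > -1" for b :: real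
    by (rule set_integrable_subset[of _ "{0..1}"])
       (use integrable_Beta[of "1 - l" "b + 1"] that assms in auto)
  have D: "set_integrable lborel {0<..<1} (\<lambda>u. u powr (- l) * (1 - u) powr l + l * (u powr (- l) * (1 - u) powr (l - 1)))"
    using assms by (intro set_integral_add set_integrable_mult_right B) auto
  show ?thesis
  proof (rule set_integrable_bound[OF D])
    show "set_borel_measurable lborel {0<..<1} (F_integrand l s)"
      unfolding set_borel_measurable_def F_integrand_def by measurable
    have "norm (F_integrand l s u) \<le> norm (u powr (- l) * (1 - u) powr l + l * (u powr (- l) * (1 - u) powr (l - 1)))"
      if u: "u \<in> {0<..<1}" for u
    proof -
      define p q where "p = u powr (- l) * (1 - u) powr l" and "q = l * (u powr (- l) * (1 - u) powr (l - 1))"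
      have pq: "p \<ge> 0" "q \<ge> 0" using assms by (auto simp: p_def q_def)
      have "\<bar>p - q\<bar> * exp (- (u * s)) \<le> (p + q) * 1"
        using u assms pq by (intro mult_mono) auto
      then show ?thesis using u pq
        by (simp add: F_integrand_eq abs_mult flip: p_def q_def)
    qed
    then show "AE x in lborel. x \<in> {0<..<1} \<longrightarrow>
      norm (F_integrand l s x) \<le> norm (x powr (- l) * (1 - x) powr l + l * (x powr (- l) * (1 - x) powr (l - 1)))"
      by blast
  qed
qed

text \<open>The bracket in \<open>F_integrand_eq\<close> is the derivative of \<open>wt l\<close>,
  so this is integration by parts; the boundary terms vanish because the weight is 0 at both
  ends.\<close>

lemma F_eq_wt_laplace:
  assumes "0 < l" "l < 1" "0 < s"
  shows "F l s = s * wt_laplace l s"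
proof -
  let ?g = "\<lambda>v. wt l v * exp (- (v * s))"
  have c: "continuous_on {0..1} ?g"
    using assms by (intro continuous_intros continuous_on_wt) auto
  have "((\<lambda>u. F_integrand l s u - s * ?g u) has_integral (?g 1 - ?g 0)) {0..1}"
  \<comment> \<open>The weight is continuous on the closed interval but has no finite derivative at
    its ends.\<close>
  proof (rule fundamental_theorem_of_calculus_interior)
    fix u :: real assume "u \<in> {0<..<1}"
    then have u: "0 < u" "u < 1" by auto
    have d1: "((\<lambda>v. v powr (1 - l)) has_field_derivative (1 - l) * u powr (- l)) (at u)"
      using has_real_derivative_powr[of u "1 - l"] u by simp
    have d2: "((\<lambda>v. (1 - v) powr l) has_field_derivative - l * (1 - u) powr (l - 1)) (at u)"
      using u by (auto intro!: DERIV_fun_powr[THEN DERIV_cong] derivative_eq_intros)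
    have pu: "u powr (1 - l) = u * u powr (- l)" "(1 - u) powr l = (1 - u) * (1 - u) powr (l - 1)"
      using u powr_add[of u 1 "-l"] powr_add[of "1 - u" 1 "l - 1"] by auto
    have "(?g has_field_derivative (F_integrand l s u - s * ?g u)) (at u)"
      unfolding wt_def F_integrand_eq[OF u]
      by (rule derivative_eq_intros d1 d2 refl)+ (simp add: pu algebra_simps)
    then show "(?g has_vector_derivative (F_integrand l s u - s * ?g u)) (at u)"
      by (simp add: has_real_derivative_iff_has_vector_derivative)
  qed (use c in auto)
  moreover have "(?g has_integral wt_laplace l s) {0..1}"
    unfolding wt_laplace_def by (intro integrable_integral integrable_continuous_real c)
  ultimately have "((\<lambda>u. (F_integrand l s u - s * ?g u) + s * ?g u) has_integral
      (?g 1 - ?g 0) + s * wt_laplace l s) {0..1}"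
    by (intro has_integral_add has_integral_mult_right)
  then have "(F_integrand l s has_integral s * wt_laplace l s) {0..1}"
    using assms by (simp add: wt_def)
  then have "(F_integrand l s has_integral s * wt_laplace l s) {0<..<1}"
    by (simp add: has_integral_Icc_iff_Ioo)
  then show ?thesis
    unfolding F_def using set_borel_integral_eq_integral(2)[OF set_integrable_F_integrand[OF assms]]
    by (simp add: integral_unique)
qed

text \<open>On \<open>{0..d}\<close> the exponential is at least \<open>exp (- (d * s))\<close>, so
  the mass of the weight there is a valid constant; it is nonzero because the weight is positive at
  \<open>d / 2\<close>. Small \<open>d\<close> yields divergence, \<open>d = 1\<close> the
  positivity of \<open>F\<close>.\<close>

lemma wt_laplace_lower:
  assumes "0 < l" "l < 1" "0 < d" "d \<le> 1"
  shows "\<exists>c>0. \<forall>s\<ge>0. c * exp (- (d * s)) \<le> wt_laplace l s"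
proof (intro exI conjI allI impI)
  let ?c = "integral {0..d} (wt l)"
  have cw: "continuous_on {0..d} (wt l)"
    using continuous_on_subset[OF continuous_on_wt[of l]] assms by auto
  have "?c \<ge> 0" by (intro integral_nonneg integrable_continuous_real cw wt_nonneg)
  moreover have "?c \<noteq> 0"
    using integral_eq_0_iff[OF cw] wt_nonneg wt_pos[of "d/2" l] assms
    by (metis atLeastAtMost_iff divide_pos_pos field_sum_of_halves less_eq_real_def less_add_same_cancel1
        linorder_not_less order.strict_trans1 zero_less_numeral)
  ultimately show "0 < ?c" by simp
  fix s :: real assume s: "s \<ge> 0"
  have c1: "continuous_on {0..1} (\<lambda>v. wt l v * exp (- (v * s)))"
    using assms by (intro continuous_intros continuous_on_wt) auto
  have c2: "continuous_on {0..d} (\<lambda>v. wt l v * exp (- (v * s)))"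
    using continuous_on_subset[OF c1] assms by auto
  have "?c * exp (- (d * s)) = integral {0..d} (\<lambda>v. wt l v * exp (- (d * s)))"
    by simp
  also have "\<dots> \<le> integral {0..d} (\<lambda>v. wt l v * exp (- (v * s)))"
    using s by (intro integral_le integrable_continuous_real c2 continuous_intros cw)
      (auto intro!: mult_left_mono wt_nonneg mult_right_mono)
  also have "\<dots> \<le> wt_laplace l s"
    unfolding wt_laplace_def using assms
    by (intro integral_subset_le integrable_continuous_real c1 c2) (auto intro!: wt_nonneg mult_nonneg_nonneg)
  finally show "?c * exp (- (d * s)) \<le> wt_laplace l s" .
qed

section \<open>Exponential integrals over the half-line and Fubini\<close>

lemma exp_neg_integrable_Ioi:
  fixes r :: real
  assumes "0 < r"
  shows "set_integrable lborel {0<..} (\<lambda>s. exp (- (s * r)))" "(LBINT s:{0<..}. exp (- (s * r))) = 1 / r"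
proof -
  have e: "einterval 0 \<infinity> = {0::real<..}"
    by (auto simp: einterval_def zero_ereal_def)
  have D: "((\<lambda>s. - exp (- (s * r)) / r) has_field_derivative exp (- (s * r))) (at s)" for s
    using assms by (auto intro!: derivative_eq_intros)
  have A: "(((\<lambda>s. - exp (- (s * r)) / r) \<circ> real_of_ereal) \<longlongrightarrow> - 1 / r) (at_right 0)"
    unfolding zero_ereal_def ereal_tendsto_simps
    by (rule tendsto_eq_intros refl | use assms in simp)+
  have B: "(((\<lambda>s. - exp (- (s * r)) / r) \<circ> real_of_ereal) \<longlongrightarrow> 0) (at_left \<infinity>)"
    unfolding ereal_tendsto_simps using assms by real_asymp
  note F = interval_integral_FTC_nonneg[of 0 \<infinity> "\<lambda>s. - exp (- (s * r)) / r" "\<lambda>s. exp (- (s * r))", OF _ D _ _ A B]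
  show "set_integrable lborel {0<..} (\<lambda>s. exp (- (s * r)))"
    using F(1) by (simp add: e)
  have "(LBINT s=0..\<infinity>. exp (- (s * r))) = 1 / r"
    using F(2) by simp
  then show "(LBINT s:{0<..}. exp (- (s * r))) = 1 / r"
    unfolding zero_ereal_def by (simp add: interval_integral_to_infinity_eq)
qed

lemma cexp_neg_integrable_Ioi:
  fixes p :: complex
  assumes "0 < Re p"
  shows "set_integrable lborel {0<..} (\<lambda>s. exp (- (of_real s * p)))"
    and "(LBINT s:{0<..}. exp (- (of_real s * p))) = 1 / p"
proof -
  have e: "einterval 0 \<infinity> = {0::real<..}"
    by (auto simp: einterval_def zero_ereal_def)
  have p: "p \<noteq> 0" using assms by auto
  show I: "set_integrable lborel {0<..} (\<lambda>s. exp (- (of_real s * p)))"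
    by (rule set_integrable_bound[OF exp_neg_integrable_Ioi(1)[OF assms]])
       (auto simp: set_borel_measurable_def)
  have D: "((\<lambda>s. - exp (- (of_real s * p)) / p) has_vector_derivative exp (- (of_real s * p))) (at s)" for s
    using p by (auto intro!: derivative_eq_intros has_vector_derivative_real_field)
  have A: "(((\<lambda>s. - exp (- (of_real s * p)) / p) \<circ> real_of_ereal) \<longlongrightarrow> - 1 / p) (at_right 0)"
    unfolding zero_ereal_def ereal_tendsto_simps
    by (rule tendsto_eq_intros refl | use p in simp)+
  \<comment> \<open>This is the norm of the antiderivative, so its limit at infinity reduces to a
    real one.\<close>
  have "((\<lambda>s. exp (- (s * Re p)) / norm p) \<longlongrightarrow> 0) at_top"
    using assms p by real_asymp
  then have B: "(((\<lambda>s. - exp (- (of_real s * p)) / p) \<circ> real_of_ereal) \<longlongrightarrow> 0) (at_left \<infinity>)"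
    unfolding ereal_tendsto_simps
    by (intro tendsto_norm_zero_cancel[where f = "\<lambda>s. - exp (- (of_real s * p)) / p"]) (simp add: norm_divide)
  have "(LBINT s=0..\<infinity>. exp (- (of_real s * p))) = 0 - (- 1 / p)"
    by (rule interval_integral_FTC_integrable[OF _ D _ _ A B]) (use I in \<open>auto simp: e\<close>)
  then show "(LBINT s:{0<..}. exp (- (of_real s * p))) = 1 / p"
    unfolding zero_ereal_def by (simp add: interval_integral_to_infinity_eq)
qed

lemma set_lborel_integral_Ioo_continuous:
  fixes f :: "real \<Rightarrow> 'a::euclidean_space"
  assumes "continuous_on {a..b} f"
  shows "set_integrable lborel {a<..<b} f" "(LBINT x:{a<..<b}. f x) = integral {a..b} f"
proof -
  show I: "set_integrable lborel {a<..<b} f"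
    by (rule set_integrable_subset[OF borel_integrable_atLeastAtMost'[OF assms]]) auto
  show "(LBINT x:{a<..<b}. f x) = integral {a..b} f"
    using set_borel_integral_eq_integral(2)[OF I] by (simp add: integral_open_interval_real)
qed

text \<open>Fubini: integrating the kernel over \<open>s\<close> first gives the Stieltjes
  transform, over \<open>v\<close> first the Laplace transform. The line \<open>Re w = 0\<close> is
  included because \<open>wt l v / v\<close> is still integrable at 0.\<close>

lemma laplace_wt_laplace:
  fixes w :: complex
  assumes l: "0 < l" "l < 1" and a: "0 < a" and w: "0 \<le> Re w"
  shows "set_integrable lborel {0<..} (\<lambda>s. of_real (wt_laplace l (a * s)) * exp (- (of_real s * w)))"
    and "(LBINT s:{0<..}. of_real (wt_laplace l (a * s)) * exp (- (of_real s * w))) = wt_stieltjes l a 1 w"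
proof -
  define f :: "real \<Rightarrow> real \<Rightarrow> complex" where
    "f = (\<lambda>v s. (indicator {0<..<1} v * indicator {0<..} s * wt l v) *\<^sub>R exp (- (of_real s * (of_real (a * v) + w))))"
  have fm [measurable]: "case_prod f \<in> borel_measurable (lborel \<Otimes>\<^sub>M lborel)"
    unfolding f_def by measurable
  have fs: "f v = (\<lambda>s. (indicator {0<..<1} v * wt l v) *\<^sub>R
      (indicator {0<..} s *\<^sub>R exp (- (of_real s * (of_real (a * v) + w)))))" for v
    by (auto simp: f_def fun_eq_iff)
  have i1: "integrable lborel (f v)" for v
  proof (cases "v \<in> {0<..<1}")
    case True
    \<comment> \<open>The open interval matters: \<open>v > 0\<close> keeps the real part positive
      even when \<open>Re w = 0\<close>.\<close>
    then have "0 < Re (of_real (a * v) + w)" using a w by (simp add: add_pos_nonneg)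
    from cexp_neg_integrable_Ioi(1)[OF this] show ?thesis
      unfolding fs set_integrable_def by (rule integrable_scaleR_right)
  qed (simp add: f_def)
  have i2: "(\<integral>s. f v s \<partial>lborel) = indicator {0<..<1} v *\<^sub>R (of_real (wt l v) / (of_real (a * v) + w))" for v
  proof (cases "v \<in> {0<..<1}")
    case True
    then have "0 < Re (of_real (a * v) + w)" using a w by (simp add: add_pos_nonneg)
    from cexp_neg_integrable_Ioi(2)[OF this] True show ?thesis
      unfolding fs set_lebesgue_integral_def by (simp add: scaleR_conv_of_real)
  qed (simp add: f_def)
  have i3: "(\<integral>s. norm (f v s) \<partial>lborel) = indicator {0<..<1} v * (wt l v / (a * v + Re w))" for v
  proof (cases "v \<in> {0<..<1}")
    case True
    then have "0 < a * v + Re w" using a w by (simp add: add_pos_nonneg)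
    have "norm (f v s) = wt l v * (indicator {0<..} s *\<^sub>R exp (- (s * (a * v + Re w))))" for s
      using True wt_nonneg[of l v] by (simp add: f_def abs_mult)
    then show ?thesis
      using exp_neg_integrable_Ioi(2)[OF \<open>0 < a * v + Re w\<close>] True
      unfolding set_lebesgue_integral_def by simp
  qed (simp add: f_def)
  \<comment> \<open>Dropping \<open>Re w\<close> from the denominator leaves this density divided by
    \<open>a\<close>. The exponents are spelled to match the Beta parameters \<open>1 - l\<close>
    and \<open>l + 1\<close>.\<close>
  have B: "set_integrable lborel {0<..<1} (\<lambda>t. t powr (1 - l - 1) * (1 - t) powr (l + 1 - 1))"
    by (rule set_integrable_subset[of _ "{0..1}", OF integrable_Beta]) (use l in auto)
  have "set_integrable lborel {0<..<1} (\<lambda>v. wt l v / (a * v + Re w))"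
  proof (rule set_integrable_bound[OF set_integrable_divide[OF B, of a]])
    have "norm (wt l v / (a * v + Re w)) \<le> norm (v powr (1 - l - 1) * (1 - v) powr (l + 1 - 1) / a)"
      if v: "v \<in> {0<..<1}" for v
    proof -
      have "wt l v / (a * v + Re w) \<le> wt l v / (a * v)"
        using v a w by (intro divide_left_mono wt_nonneg) (auto intro!: mult_pos_pos add_pos_nonneg)
      also have "\<dots> = v powr (1 - l - 1) * (1 - v) powr (l + 1 - 1) / a"
        using v a by (simp add: wt_def powr_diff field_simps powr_minus)
      finally show ?thesis
        using v a w wt_nonneg[of l v] by (simp add: abs_mult)
    qed
    then show "AE v in lborel. v \<in> {0<..<1} \<longrightarrow> norm (wt l v / (a * v + Re w))
        \<le> norm (v powr (1 - l - 1) * (1 - v) powr (l + 1 - 1) / a)"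
      by blast
  qed (auto simp: set_borel_measurable_def)
  then have P: "integrable (lborel \<Otimes>\<^sub>M lborel) (case_prod f)"
    by (intro lborel_pair.Fubini_integrable fm) (auto simp: i1 i3 set_integrable_def)
  have j: "(\<integral>v. f v s \<partial>lborel) = indicator {0<..} s *\<^sub>R (of_real (wt_laplace l (a * s)) * exp (- (of_real s * w)))" for s
  proof -
    have "exp (- (of_real s * (of_real (a * v) + w))) = of_real (exp (- (v * (a * s)))) * exp (- (of_real s * w))" for v
      by (simp add: algebra_simps flip: exp_of_real exp_add)
    then have "f v s = of_real (indicator {0<..<1} v *\<^sub>R (wt l v * exp (- (v * (a * s))))) *
        (indicator {0<..} s *\<^sub>R exp (- (of_real s * w)))" for v
      by (simp only: f_def) (simp add: scaleR_conv_of_real)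
    then have "(\<integral>v. f v s \<partial>lborel) = of_real (LBINT v:{0<..<1}. wt l v * exp (- (v * (a * s)))) *
        (indicator {0<..} s *\<^sub>R exp (- (of_real s * w)))"
      unfolding set_lebesgue_integral_def by (simp del: of_real_mult scaleR_conv_of_real real_scaleR_def)
    also have "(LBINT v:{0<..<1}. wt l v * exp (- (v * (a * s)))) = wt_laplace l (a * s)"
      unfolding wt_laplace_def using l
      by (intro set_lborel_integral_Ioo_continuous continuous_intros continuous_on_wt)
    finally show ?thesis by simp
  qed
  show "set_integrable lborel {0<..} (\<lambda>s. of_real (wt_laplace l (a * s)) * exp (- (of_real s * w)))"
    using lborel_pair.integrable_snd[OF P] unfolding j set_integrable_def .
  have K: "set_integrable lborel {0<..<1} (\<lambda>v. of_real (wt l v) / (of_real (a * v) + w))"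
    using lborel_pair.integrable_fst[OF P] unfolding i2 set_integrable_def .
  have "(LBINT s:{0<..}. of_real (wt_laplace l (a * s)) * exp (- (of_real s * w)))
      = (LBINT v:{0<..<1}. of_real (wt l v) / (of_real (a * v) + w))"
    using lborel_pair.Fubini_integral[OF P] unfolding i2 j set_lebesgue_integral_def .
  also have "\<dots> = wt_stieltjes l a 1 w"
    using set_borel_integral_eq_integral(2)[OF K] by (simp add: wt_stieltjes_def integral_open_interval_real)
  finally show "(LBINT s:{0<..}. of_real (wt_laplace l (a * s)) * exp (- (of_real s * w))) = wt_stieltjes l a 1 w" .
qed

subsection \<open>Stieltjes representation\<close>

lemma Gamma_reflection_real:
  fixes l :: real
  assumes "0 < l" "l < 1"
  shows "Gamma l * Gamma (1 - l) = pi / sin (l * pi)"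
proof -
  have "complex_of_real (Gamma l * Gamma (1 - l)) = Gamma (of_real l) * Gamma (1 - of_real l)"
    using Gamma_complex_of_real[of l] Gamma_complex_of_real[of "1 - l"] by simp
  also have "\<dots> = of_real (pi / sin (l * pi))"
    unfolding Gamma_reflection_complex of_real_mult[symmetric] sin_of_real of_real_divide[symmetric]
    by (simp only: mult.commute)
  finally show ?thesis by (simp only: of_real_eq_iff)
qed

lemma sin_mult_pi_pos:
  assumes "0 < l" "l < 1"
  shows "0 < sin (l * pi)"
  using assms by (intro sin_gt_zero) auto

text \<open>The moments of the weight are binomial coefficients up to sign. The reflection formula
  settles \<open>k = 0\<close>; afterwards both sides acquire the factor
  \<open>(k + 2 - l) / (k + 3)\<close>.\<close>

lemma Beta_eq_gchoose:
  assumes l: "0 < l" "l < 1"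
  shows "sin (l * pi) / pi * Beta (of_nat k + 2 - l) (l + 1) = - ((- 1) ^ k) * (l gchoose (k + 2))"
proof (induction k)
  case 0
  have "Beta (2 - l) (l + 1) = Gamma (1 - l + 1) * Gamma (l + 1) / Gamma 3"
    by (simp add: Beta_def algebra_simps)
  also have "Gamma (1 - l + 1) = (1 - l) * Gamma (1 - l)"
    by (rule Gamma_plus1) (use l in auto)
  also have "Gamma (l + 1) = l * Gamma l"
    by (rule Gamma_plus1) (use l in auto)
  also have "Gamma (3::real) = 2"
    using Gamma_fact[of 2, where 'a = real] by simp
  finally have "Beta (2 - l) (l + 1) = (1 - l) * l * (Gamma l * Gamma (1 - l)) / 2"
    by simp
  then show ?case
    using sin_mult_pi_pos[OF l] unfolding Gamma_reflection_real[OF l]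
    by (simp add: gbinomial_Suc_rec numeral_2_eq_2 field_simps gbinomial_prod_rev)
next
  case (Suc k)
  have "(of_nat k + 2 - l) + (l + 1) = (of_nat k + 3 :: real)" by simp
  then have "(of_nat k + 3) * Beta (of_nat k + 2 - l + 1) (l + 1) = (of_nat k + 2 - l) * Beta (of_nat k + 2 - l) (l + 1)"
    using Beta_plus1_left[of "of_nat k + 2 - l" "l + 1"] nonpos_Ints_nonpos[of "of_nat k + 2 - l"] l by auto
  then have "Beta (of_nat (Suc k) + 2 - l) (l + 1) = (of_nat k + 2 - l) / (of_nat k + 3) * Beta (of_nat k + 2 - l) (l + 1)"
    by (simp add: field_simps)
  then have "sin (l * pi) / pi * Beta (of_nat (Suc k) + 2 - l) (l + 1)
      = (of_nat k + 2 - l) / (of_nat k + 3) * (sin (l * pi) / pi * Beta (of_nat k + 2 - l) (l + 1))"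
    by (simp add: mult_ac)
  also have "\<dots> = (of_nat k + 2 - l) / (of_nat k + 3) * (- ((- 1) ^ k) * (l gchoose (k + 2)))"
    by (simp only: Suc.IH)
  also have "\<dots> = - ((- 1) ^ Suc k) * (l gchoose (Suc k + 2))"
    using gbinomial_absorb_comp[of l "k+2"] gbinomial_absorption[of "k + 2" "l"]
    by (simp add: field_simps)
  finally show ?case .
qed

text \<open>Expanding \<open>1 / (1 + q * v)\<close> as a geometric series and integrating termwise
  produces the moments of the weight, which are Beta values.\<close>

lemma integral_wt_geometric:
  assumes l: "0 < l" "l < 1" and q: "0 < q" "q < 1"
  shows "(\<lambda>k. (- q) ^ k * Beta (of_nat k + 2 - l) (l + 1)) sums integral {0..1} (\<lambda>v. wt l v / (1 + q * v))"
proof -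
  define f :: "nat \<Rightarrow> real \<Rightarrow> real" where "f = (\<lambda>k v. indicator {0..1} v * (wt l v * (- q * v) ^ k))"
  have c: "continuous_on {0..1} (\<lambda>v. wt l v * (- q * v) ^ k)" for k
    using l by (intro continuous_intros continuous_on_wt)
  have S: "set_integrable lborel {0..1} (\<lambda>v. wt l v * (- q * v) ^ k)" for k
    by (intro borel_integrable_atLeastAtMost' c)
  have i: "integrable lborel (f k)" for k
    using S[of k] unfolding set_integrable_def f_def by simp
  have v: "(\<integral>v. f k v \<partial>lborel) = (- q) ^ k * Beta (of_nat k + 2 - l) (l + 1)" for k
  proof -
    have "(\<integral>v. f k v \<partial>lborel) = integral {0..1} (\<lambda>v. wt l v * (- q * v) ^ k)"
      using set_borel_integral_eq_integral(2)[OF S[of k]] by (simp add: f_def set_lebesgue_integral_def)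
    also have "\<dots> = integral {0..1} (\<lambda>v. (- q) ^ k * (v powr (of_nat k + 2 - l - 1) * (1 - v) powr (l + 1 - 1)))"
    proof (rule integral_cong)
      fix v :: real assume v: "v \<in> {0..1}"
      have "v powr (of_nat k + 2 - l - 1) = v powr (1 - l) * v ^ k"
      \<comment> \<open>Adding exponents needs a positive base; at 0 both sides vanish since
        \<open>0 powr b = 0\<close>.\<close>
      proof (cases "v = 0")
        case True
        then show ?thesis by simp
      next
        case False
        with v have "v > 0" by simp
        then show ?thesis
          by (simp add: powr_add[symmetric] powr_realpow[symmetric] algebra_simps)
      qed
      then show "wt l v * (- q * v) ^ k = (- q) ^ k * (v powr (of_nat k + 2 - l - 1) * (1 - v) powr (l + 1 - 1))"
        by (simp only: wt_def power_mult_distrib) simp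
    qed
    also have "\<dots> = (- q) ^ k * integral {0..1} (\<lambda>v. v powr (of_nat k + 2 - l - 1) * (1 - v) powr (l + 1 - 1))"
      by (rule integral_mult_right)
    also have "integral {0..1} (\<lambda>v. v powr (of_nat k + 2 - l - 1) * (1 - v) powr (l + 1 - 1)) = Beta (of_nat k + 2 - l) (l + 1)"
      by (rule integral_unique[OF has_integral_Beta_real]) (use l in auto)
    finally show ?thesis .
  qed
  have g: "(\<lambda>k. f k v) sums (indicator {0..1} v * (wt l v / (1 + q * v)))" for v
  proof (cases "v \<in> {0..1}")
    case True
    then have "q * v \<le> q" using q by (intro mult_left_le) auto
    then have "q * v < 1" using q by linarith
    then have "norm (- q * v) < 1" using True q by (simp add: abs_mult)
    from sums_mult[OF geometric_sums[OF this], of "wt l v"] show ?thesis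
      using True by (simp add: f_def)
  qed (simp add: f_def)
  \<comment> \<open>A majorant summable in \<open>k\<close> and integrable in \<open>v\<close>,
    which justifies the interchange of sum and integral.\<close>
  have n: "norm (f k v) \<le> q ^ k * (indicator {0..1} v * wt l v)" for k v
  proof (cases "v \<in> {0..1}")
    case True
    then have "wt l v * (q * v) ^ k \<le> wt l v * q ^ k"
      using q wt_nonneg by (intro mult_left_mono power_mono) (auto intro!: mult_left_le)
    then show ?thesis using True q wt_nonneg by (simp add: f_def abs_mult power_abs mult_ac)
  qed (simp add: f_def)
  have I0: "integrable lborel (\<lambda>v. indicator {0..1} v * wt l v)"
    using i[of 0] by (simp add: f_def)
  have "(\<lambda>k. \<integral>v. f k v \<partial>lborel) sums (\<integral>v. (\<Sum>k. f k v) \<partial>lborel)"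
  proof (rule sums_integral[OF i])
    have "summable (\<lambda>k. norm (f k v))" for v
    proof (rule summable_comparison_test)
      show "summable (\<lambda>k. q ^ k * (indicator {0..1} v * wt l v))"
        using q by (intro summable_mult2 summable_geometric) auto
    qed (use n in auto)
    then show "AE v in lborel. summable (\<lambda>k. norm (f k v))"
      by simp
    show "summable (\<lambda>k. \<integral>v. norm (f k v) \<partial>lborel)"
    proof (rule summable_comparison_test)
      show "summable (\<lambda>k. q ^ k * (\<integral>v. indicator {0..1} v * wt l v \<partial>lborel))"
        using q by (intro summable_mult2 summable_geometric) auto
      have "(\<integral>v. norm (f k v) \<partial>lborel) \<le> (\<integral>v. q ^ k * (indicator {0..1} v * wt l v) \<partial>lborel)" for k
        by (intro integral_mono integrable_mult_right I0 integrable_norm i n)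
      then show "\<exists>N. \<forall>k\<ge>N. norm (\<integral>v. norm (f k v) \<partial>lborel) \<le> q ^ k * (\<integral>v. indicator {0..1} v * wt l v \<partial>lborel)"
        by simp
    qed
  qed
  also have "(\<lambda>v. \<Sum>k. f k v) = (\<lambda>v. indicator {0..1} v * (wt l v / (1 + q * v)))"
    using g by (auto simp: fun_eq_iff sums_iff)
  also have "(\<integral>v. indicator {0..1} v * (wt l v / (1 + q * v)) \<partial>lborel) = integral {0..1} (\<lambda>v. wt l v / (1 + q * v))"
  proof -
    have "1 + q * v \<noteq> 0" if "v \<in> {0..1}" for v
      using q that by (simp add: add_pos_nonneg order_less_imp_not_eq2)
    then have "set_integrable lborel {0..1} (\<lambda>v. wt l v / (1 + q * v))"
      using l by (intro borel_integrable_atLeastAtMost' continuous_intros continuous_on_wt) auto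
    from set_borel_integral_eq_integral(2)[OF this] show ?thesis
      by (simp add: set_lebesgue_integral_def)
  qed
  finally show ?thesis unfolding v .
qed

text \<open>The terms of index 0 and 1 of the binomial series give \<open>1 + l * q\<close>; the
  tail from index 2 on matches the geometric expansion of the integral term by term, whence the
  factor \<open>q\<close> squared.\<close>

lemma one_plus_powr_eq_integral:
  assumes l: "0 < l" "l < 1" and q: "0 < q" "q < 1"
  shows "(1 + q) powr l = 1 + l * q - sin (l * pi) / pi * q\<^sup>2 * integral {0..1} (\<lambda>v. wt l v / (1 + q * v))"
proof -
  let ?J = "integral {0..1} (\<lambda>v. wt l v / (1 + q * v))"
  have "(\<lambda>k. (l gchoose k) * q ^ k) sums (1 + q) powr l"
    using q by (intro gen_binomial_real) auto
  then have "(\<lambda>k. (l gchoose (k + 2)) * q ^ (k + 2)) sums ((1 + q) powr l - (\<Sum>k<2. (l gchoose k) * q ^ k))"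
    by (rule sums_split_initial_segment)
  then have s1: "(\<lambda>k. (l gchoose (k + 2)) * q ^ (k + 2)) sums ((1 + q) powr l - (1 + l * q))"
    by (simp add: numeral_2_eq_2)
  have "(\<lambda>k. - (sin (l * pi) / pi * q\<^sup>2) * ((- q) ^ k * Beta (of_nat k + 2 - l) (l + 1))) sums
      (- (sin (l * pi) / pi * q\<^sup>2) * ?J)"
    by (intro sums_mult integral_wt_geometric l q)
  also have "(\<lambda>k. - (sin (l * pi) / pi * q\<^sup>2) * ((- q) ^ k * Beta (of_nat k + 2 - l) (l + 1)))
      = (\<lambda>k. (l gchoose (k + 2)) * q ^ (k + 2))"
  proof
    fix k
    have "- (sin (l * pi) / pi * q\<^sup>2) * ((- q) ^ k * Beta (of_nat k + 2 - l) (l + 1))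
      = - q\<^sup>2 * (- q) ^ k * (sin (l * pi) / pi * Beta (of_nat k + 2 - l) (l + 1))" by simp
    also have "\<dots> = (l gchoose (k + 2)) * q ^ (k + 2)"
      unfolding Beta_eq_gchoose[OF l] power_minus[of q] by (simp add: power_add power2_eq_square flip: power_mult_distrib)
    finally show "- (sin (l * pi) / pi * q\<^sup>2) * ((- q) ^ k * Beta (of_nat k + 2 - l) (l + 1))
      = (l gchoose (k + 2)) * q ^ (k + 2)" .
  qed
  finally show ?thesis
    using sums_unique2[OF s1] by fastforce
qed

text \<open>Homogeneity: factor out \<open>w\<close> and take \<open>q = a / w\<close>, which is
  below 1 as \<open>a < w\<close>.\<close>

lemma powr_mean_eq_wt_stieltjes_real:
  assumes l: "0 < l" "l < 1" and w: "0 < a" "a < w"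
  shows "(w + a) powr l * w powr (1 - l)
    = w + l * a - sin (l * pi) / pi * a\<^sup>2 * wt_stieltjes l a 1 w"
proof -
  have "wt_stieltjes l a 1 w = integral {0..1} (\<lambda>v. 1 / w * (wt l v / (1 + a / w * v)))"
    unfolding wt_stieltjes_def using w by (intro integral_cong) (simp add: field_simps)
  also have "\<dots> = 1 / w * integral {0..1} (\<lambda>v. wt l v / (1 + a / w * v))"
    by (rule integral_mult_right)
  finally have I: "integral {0..1} (\<lambda>v. wt l v / (1 + a / w * v)) = w * wt_stieltjes l a 1 w"
    using w by simp
  have "w + a = w * (1 + a / w)"
    using w by (simp add: field_simps)
  then have "(w + a) powr l = w powr l * (1 + a / w) powr l"
    using w by (simp add: powr_mult)
  then have "(w + a) powr l * w powr (1 - l) = w * (1 + a / w) powr l"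
    using w powr_add[of w l "1 - l"] by simp
  also have "(1 + a / w) powr l = 1 + l * (a / w) - sin (l * pi) / pi * (a / w)\<^sup>2 * (w * wt_stieltjes l a 1 w)"
    using one_plus_powr_eq_integral[OF l, of "a / w"] w unfolding I by simp
  also have "w * \<dots> = w + l * a - sin (l * pi) / pi * a\<^sup>2 * wt_stieltjes l a 1 w"
    using w by (simp add: field_simps power2_eq_square)
  finally show ?thesis .
qed

section \<open>Continuation to the slit plane\<close>

lemma wt_stieltjes_of_real:
  assumes "0 < l" "l < 1" "0 \<le> a" "0 < w"
  shows "wt_stieltjes l a n (complex_of_real w) = of_real (wt_stieltjes l a n w)"
proof -
  have "a * v + w \<noteq> 0" if "v \<in> {0..1}" for v
    using assms that by (simp add: add_nonneg_pos order_less_imp_not_eq2)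
  then have "(\<lambda>v. wt l v / (a * v + w) ^ n) integrable_on {0..1}"
    using assms by (intro integrable_continuous_real continuous_intros continuous_on_wt) auto
  from integral_linear[OF this bounded_linear_of_real[where 'a = complex]] show ?thesis
    by (simp add: wt_stieltjes_def o_def)
qed

lemma slit_Im_Re: "z \<notin> complex_of_real ` {..c} \<longleftrightarrow> c < Re z \<or> Im z \<noteq> 0"
  by (auto simp: image_iff complex_eq_iff)

text \<open>Identity theorem: both sides are holomorphic on the connected slit plane and agree on
  the real ray beyond \<open>a\<close>, whose points are limit points of it.\<close>

lemma powr_mean_eq_wt_stieltjes:
  fixes w :: complex
  assumes l: "0 < l" "l < 1" and a: "0 < a" and w: "w \<notin> of_real ` {..0}"
  shows "(w + of_real a) powr of_real l * w powr of_real (1 - l)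
    = w + of_real (l * a) - of_real (sin (l * pi) / pi * a\<^sup>2) * wt_stieltjes l a 1 w"
proof -
  define S where "S = - complex_of_real ` {..0}"
  have S: "w \<in> S \<longleftrightarrow> 0 < Re w \<or> Im w \<noteq> 0" for w
    by (simp add: S_def slit_Im_Re)
  have oS: "open S"
    unfolding S_def by (intro open_Compl closed_slot_left)
  have cS: "connected S"
    unfolding S_def by (intro starlike_imp_connected starlike_slotted_complex_plane_left)
  have nz: "of_real (a * v) + w \<noteq> 0" if "w \<in> S" "v \<in> {0..1}" for w v
  proof -
    have "0 \<le> a * v" using that a by simp
    then show ?thesis using that(1) unfolding S complex_eq_iff by auto
  qed
  have K: "wt_stieltjes l a 1 holomorphic_on S"
    unfolding holomorphic_on_open[OF oS] using wt_stieltjes_has_field_derivative[OF l oS _ nz] by blast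
  let ?g = "\<lambda>w. (w + of_real a) powr of_real l * w powr of_real (1 - l)
     - (w + of_real (l * a) - of_real (sin (l * pi) / pi * a\<^sup>2) * wt_stieltjes l a 1 w)"
  have "?g w = 0"
  proof (rule analytic_continuation[where f = ?g and S = S and U = "of_real ` {a<..}" and \<xi> = "of_real (a + 1)"])
    show "?g holomorphic_on S"
      using a by (intro holomorphic_intros K) (auto simp: S complex_nonpos_Reals_iff)
    show "of_real ` {a<..} \<subseteq> S" "complex_of_real (a + 1) \<in> S"
      using a by (auto simp: S)
    show "complex_of_real (a + 1) islimpt of_real ` {a<..}"
      unfolding islimpt_approachable
    proof (intro allI impI bexI conjI)
      fix e :: real assume "e > 0"
      then show "complex_of_real (a + 1 + e / 2) \<in> of_real ` {a<..}"
        "complex_of_real (a + 1 + e / 2) \<noteq> of_real (a + 1)"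
        "dist (complex_of_real (a + 1 + e / 2)) (of_real (a + 1)) < e"
        by (auto simp: dist_norm simp del: of_real_add simp flip: of_real_diff)
    qed
    show "?g z = 0" if z: "z \<in> of_real ` {a<..}" for z :: complex
    proof -
      obtain t where t: "z = of_real t" "a < t" using z by auto
      have "(z + of_real a) powr of_real l = of_real ((t + a) powr l)"
        "z powr of_real (1 - l) = of_real (t powr (1 - l))"
        unfolding t using powr_of_real[of "t + a" l] powr_of_real[of t "1 - l"] t a by auto
      moreover have "wt_stieltjes l a 1 z = of_real (wt_stieltjes l a 1 t)"
        unfolding t using l a t by (intro wt_stieltjes_of_real) auto
      ultimately show ?thesis
        using arg_cong[OF powr_mean_eq_wt_stieltjes_real[OF l a \<open>a < t\<close>], of complex_of_real] t
        by simp
    qed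
    show "w \<in> S" using w by (simp add: S_def)
  qed (intro oS cS)+
  then show ?thesis by simp
qed

text \<open>The series argument covers only \<open>y + t > x - y\<close>; the complex identity
  brings in the rest of the half-line. The case \<open>x = y\<close> is separate because that
  identity requires \<open>a > 0\<close>.\<close>

lemma wgm_eq_wt_stieltjes_real:
  assumes l: "0 < l" "l < 1" and y: "y \<le> x" and t: "- y < t"
  shows "wgm x y l t = (y + t) + l * (x - y) - sin (l * pi) / pi * (x - y)\<^sup>2 * wt_stieltjes l (x - y) 1 (y + t)"
proof (cases "y = x")
  case True
  then show ?thesis using t by (simp add: wgm_def flip: powr_add)
next
  case False
  define a w where "a = x - y" and "w = y + t"
  have aw: "0 < a" "0 < w" using False y t by (auto simp: a_def w_def)
  have "complex_of_real w \<notin> of_real ` {..0}" using aw by (simp add: slit_Im_Re)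
  then have "complex_of_real ((w + a) powr l * w powr (1 - l))
      = of_real (w + l * a - sin (l * pi) / pi * a\<^sup>2 * wt_stieltjes l a 1 w)"
    using powr_mean_eq_wt_stieltjes[OF l aw(1), of "of_real w"] aw wt_stieltjes_of_real[OF l, of a w 1]
      powr_of_real[of "w + a" l] powr_of_real[of w "1 - l"]
    by auto
  then have "(w + a) powr l * w powr (1 - l) = w + l * a - sin (l * pi) / pi * a\<^sup>2 * wt_stieltjes l a 1 w"
    by (simp only: of_real_eq_iff)
  then show ?thesis by (simp add: wgm_def a_def w_def add.commute)
qed

subsection \<open>Bernstein property and integral representation\<close>

text \<open>The mean is an affine function of slope 1 minus a nonnegative multiple of a Stieltjes
  transform, whose derivatives alternate in sign.\<close>

lemma bernstein_wgm_le:
  assumes l: "0 < l" "l < 1" and y: "y \<le> x"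
  shows "bernstein_function_on {- y<..} (wgm x y l)"
proof -
  define c where "c = sin (l * pi) / pi * (x - y)\<^sup>2"
  have c: "0 \<le> c" using sin_mult_pi_pos[OF l] by (simp add: c_def)
  define K where "K n t = wt_stieltjes l (x - y) n (y + t)" for n and t :: real
  have pos: "0 < (x - y) * v + w" if "w \<in> {0<..}" "v \<in> {0..1}" for v w
    using y that by (auto intro!: add_nonneg_pos)
  have DK: "(K n has_real_derivative - of_nat n * K (Suc n) t) (at t)" if t: "- y < t" for n t
  proof -
    have "(wt_stieltjes l (x - y) n has_real_derivative - of_nat n * K (Suc n) t) (at (y + t))"
      unfolding K_def
      by (rule wt_stieltjes_has_field_derivative[OF l, of "{0<..}"]) (use t pos in force)+
    then show ?thesis
      unfolding K_def by (simp add: DERIV_shift add.commute[of y])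
  qed
  have K0: "0 \<le> K n t" if t: "- y < t" for n t
  proof -
    have p: "0 < (x - y) * v + (y + t)" if "v \<in> {0..1}" for v
      using pos[of "y + t" v] that t by simp
    then have "0 \<le> integral {0..1} (\<lambda>v. wt l v / ((x - y) * v + (y + t)) ^ n)"
      using l by (intro integral_nonneg integrable_continuous_real continuous_intros continuous_on_wt)
        (fastforce intro!: divide_nonneg_nonneg wt_nonneg simp: less_imp_le)+
    then show ?thesis by (simp add: K_def wt_stieltjes_def)
  qed
  \<comment> \<open>Iterating \<open>DK\<close> from \<open>K 1\<close> gives the factor
    \<open>(- 1) ^ n * fact n\<close>; the affine part survives only for \<open>n = 0\<close> and
    \<open>n = 1\<close>.\<close>
  define D where "D n t =
      (if n = 0 then y + t + l * (x - y) else if n = 1 then 1 else 0) - c * (- 1) ^ n * fact n * K (Suc n) t" for n t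
  have DD: "(D n has_real_derivative D (Suc n) t) (at t within {- y<..})" if t: "- y < t" for n t
  proof -
    have P: "((\<lambda>t. if n = 0 then y + t + l * (x - y) else if n = 1 then 1 else 0)
        has_real_derivative (if n = 0 then 1 else 0)) (at t)"
      by (auto intro!: derivative_eq_intros)
    have "- (c * (- 1) ^ n * fact n * (- of_nat (Suc n) * K (Suc (Suc n)) t))
        = - (c * (- 1) ^ Suc n * fact (Suc n) * K (Suc (Suc n)) t)"
      by (simp add: algebra_simps)
    then have "D (Suc n) t = (if n = 0 then 1 else 0) - c * (- 1) ^ n * fact n * (- of_nat (Suc n) * K (Suc (Suc n)) t)"
      unfolding D_def by simp
    then have "(D n has_real_derivative D (Suc n) t) (at t)"
      unfolding D_def[of n] using DERIV_diff[OF P DERIV_cmult[OF DK[OF t, of "Suc n"]]] by simp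
    then show ?thesis
      by (rule has_field_derivative_at_within)
  qed
  have d: "derivatives_on {- y<..} (wgm x y l) D"
    unfolding derivatives_on_def
    using DD wgm_eq_wt_stieltjes_real[OF l y] by (auto simp: D_def c_def K_def)
  have "completely_monotonic_on {- y<..} (D 1)"
    unfolding completely_monotonic_on_def
  proof (intro exI[of _ "\<lambda>n. D (Suc n)"] conjI allI ballI)
    show "derivatives_on {- y<..} (D 1) (\<lambda>n. D (Suc n))"
      unfolding derivatives_on_def using DD by auto
    fix n t assume "t \<in> {- y<..}"
    then have "0 \<le> c * fact (Suc n) * K (Suc (Suc n)) t"
      using c K0 by (intro mult_nonneg_nonneg) auto
    \<comment> \<open>The minus before \<open>c\<close> cancels the extra sign of index
      \<open>Suc n\<close>, leaving a square.\<close>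
    moreover have "(- 1) ^ n * D (Suc n) t = (if n = 0 then 1 else 0) + ((- 1) ^ n * (- 1) ^ n) * (c * fact (Suc n) * K (Suc (Suc n)) t)"
      by (simp add: D_def algebra_simps)
    ultimately show "0 \<le> (- 1) ^ n * D (Suc n) t"
      by (simp flip: power_mult_distrib)
  qed
  then show ?thesis
    unfolding bernstein_function_on_def using d by (auto simp: wgm_def)
qed

text \<open>Swapping \<open>x\<close> with \<open>y\<close> and \<open>l\<close> with
  \<open>1 - l\<close> leaves the mean unchanged.\<close>

lemma bernstein_wgm:
  assumes l: "0 < l" "l < 1"
  shows "bernstein_function_on {- min x y<..} (wgm x y l)"
proof (cases "y \<le> x")
  case True
  then show ?thesis using bernstein_wgm_le[OF l True] by (simp add: min_absorb2)
next
  case False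
  then have xy: "x \<le> y" by simp
  have "wgm x y l = (wgm y x (1 - l) :: real \<Rightarrow> real)"
    by (simp add: wgm_def fun_eq_iff mult.commute)
  then show ?thesis using bernstein_wgm_le[OF _ _ xy, of "1 - l"] l xy by (simp add: min_absorb1)
qed

section \<open>Convergence and value of the integral representation\<close>

text \<open>The growth of \<open>exp (- (s * Re w))\<close> beats the slow decay of the transform,
  so the norm of the integrand stays above a positive constant.\<close>

lemma not_integrable_laplace_wt_laplace:
  fixes w :: complex
  assumes l: "0 < l" "l < 1" and a: "0 < a" and w: "Re w < 0"
  shows "\<not> set_integrable lborel {0<..} (\<lambda>s. of_real (wt_laplace l (a * s)) * exp (- (of_real s * w)))"
proof
  assume I: "set_integrable lborel {0<..} (\<lambda>s. of_real (wt_laplace l (a * s)) * exp (- (of_real s * w)))"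
  \<comment> \<open>Chosen so that the lower bound at rate \<open>d * a\<close> is absorbed by the
    growth rate \<open>- Re w\<close>; the cap 1 keeps \<open>{0..d}\<close> inside the range of
    integration.\<close>
  define d where "d = min 1 (- Re w / a)"
  have d: "0 < d" "d \<le> 1" "d * a \<le> - Re w"
    using w a by (auto simp: d_def min_def field_simps)
  obtain c where c: "0 < c" "\<And>s. 0 \<le> s \<Longrightarrow> c * exp (- (d * s)) \<le> wt_laplace l s"
    using wt_laplace_lower[OF l d(1,2)] by blast
  have "norm c \<le> norm (of_real (wt_laplace l (a * s)) * exp (- (of_real s * w)))" if s: "0 < s" for s
  proof -
    have "s * (d * a) \<le> s * - Re w"
      using d s by (intro mult_left_mono) auto
    then have "c \<le> c * exp (- (d * (a * s)) + - (s * Re w))"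
      using c by (simp add: algebra_simps)
    also have "\<dots> \<le> wt_laplace l (a * s) * exp (- (s * Re w))"
      unfolding exp_add mult.assoc[symmetric] using c(2)[of "a * s"] a s
      by (intro mult_right_mono) (auto simp: mult.assoc)
    finally show ?thesis
      using c by (simp add: norm_mult abs_mult) (smt (verit) exp_gt_zero mult_minus_left mult_neg_pos)
  qed
  then have "set_integrable lborel {0<..} (\<lambda>s::real. c)"
    by (intro set_integrable_bound[OF I]) (auto simp: set_borel_measurable_def)
  then have "set_integrable lborel {0<..} (\<lambda>s::real. (1 / c) * c)"
    by (rule set_integrable_mult_right)
  then have "integrable lborel (indicator {0::real<..} :: real \<Rightarrow> real)"
    using c by (simp add: set_integrable_def)
  then have "emeasure lborel {0::real<..} < \<infinity>"
    by (simp add: integrable_indicator_iff)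
  then obtain r where r: "emeasure lborel {0::real<..} = ennreal r" "0 \<le> r"
    by (metis ennreal_cases infinity_ennreal_def less_irrefl)
  \<comment> \<open>A bounded interval inside the half-line already exceeds its supposed measure
    \<open>r\<close>.\<close>
  have "ennreal (r + 1) = emeasure lborel {0<..r + 1}"
    using r by simp
  also have "\<dots> \<le> ennreal r"
    unfolding r(1)[symmetric] by (intro emeasure_mono) auto
  finally show False using r by (simp add: ennreal_le_iff)
qed

text \<open>With \<open>y \<le> x\<close> the cut of the first factor lies inside that of the
  second.\<close>

lemma wgm_holomorphic_on:
  assumes "y \<le> x"
  shows "(wgm x y l :: complex \<Rightarrow> complex) holomorphic_on - complex_of_real ` {.. - y}"
proof -
  have "of_real x + z \<notin> \<real>\<^sub>\<le>\<^sub>0" "of_real y + z \<notin> \<real>\<^sub>\<le>\<^sub>0" if "z \<in> - complex_of_real ` {.. - y}" for z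
    using that assms unfolding Compl_iff slit_Im_Re complex_nonpos_Reals_iff by auto
  then show ?thesis
    unfolding wgm_def[abs_def] by (intro holomorphic_intros)
qed

text \<open>The factor \<open>1 - exp (- (s * z))\<close> splits the integrand into Laplace kernels
  at \<open>y\<close> and \<open>y + z\<close>. The first always converges, so the second decides
  integrability.\<close>

lemma wgm_integral_representation:
  fixes z :: complex
  assumes l: "0 < l" "l < 1" and xy: "0 < y" "y < x" and z: "z \<notin> complex_of_real ` {.. - y}"
  shows "set_integrable lborel {0<..} (wgm_integrand x y l z) \<longleftrightarrow> - y \<le> Re z" (is ?I)
    and "- y \<le> Re z \<Longrightarrow> wgm x y l z = of_real (x powr l * y powr (1 - l)) + z
           + of_real (sin (l * pi) / pi * (x - y)) * (LBINT s:{0<..}. wgm_integrand x y l z s)"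
proof -
  define a where "a = x - y"
  define h where "h w s = of_real (wt_laplace l (a * s)) * exp (- (complex_of_real s * w))" for w s
  have a: "0 < a" using xy by (simp add: a_def)
  have eq: "wgm_integrand x y l z s = of_real a * (h (of_real y) s - h (of_real y + z) s)" if "0 < s" for s
  proof -
    have "F l ((x - y) * s) / s = a * wt_laplace l (a * s)"
      using F_eq_wt_laplace[OF l, of "a * s"] a that by (simp add: a_def)
    then show ?thesis
      by (simp add: wgm_integrand_def h_def algebra_simps exp_of_real[symmetric] exp_add[symmetric])
  qed
  have hy: "set_integrable lborel {0<..} (h (of_real y))"
      "(LBINT s:{0<..}. h (of_real y) s) = wt_stieltjes l a 1 (of_real y)"
    unfolding h_def using laplace_wt_laplace[OF l a, of "of_real y"] xy by auto
  have iff: "set_integrable lborel {0<..} (wgm_integrand x y l z) \<longleftrightarrow>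
      set_integrable lborel {0<..} (\<lambda>s. of_real a * (h (of_real y) s - h (of_real y + z) s))"
    by (intro set_integrable_cong refl) (simp add: eq)
  show ?I
  proof
    assume "- y \<le> Re z"
    then have "set_integrable lborel {0<..} (h (of_real y + z))"
      unfolding h_def by (intro laplace_wt_laplace l a) auto
    then show "set_integrable lborel {0<..} (wgm_integrand x y l z)"
      unfolding iff by (intro set_integrable_mult_right set_integral_diff hy)
  next
    assume "set_integrable lborel {0<..} (wgm_integrand x y l z)"
    then have "set_integrable lborel {0<..} (\<lambda>s. (1 / of_real a) * (of_real a * (h (of_real y) s - h (of_real y + z) s)))"
      unfolding iff by (rule set_integrable_mult_right)
    \<comment> \<open>Subtracting from the integrable piece at \<open>y\<close> isolates the one at
      \<open>y + z\<close>.\<close>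
    note set_integral_diff(1)[OF hy(1) this]
    moreover have "(\<lambda>s. h (of_real y) s - (1 / of_real a) * (of_real a * (h (of_real y) s - h (of_real y + z) s))) = h (of_real y + z)"
      using a by (simp add: fun_eq_iff)
    ultimately have "set_integrable lborel {0<..} (h (of_real y + z))"
      by simp
    then show "- y \<le> Re z"
      using not_integrable_laplace_wt_laplace[OF l a, of "of_real y + z"] unfolding h_def by fastforce
  qed
  assume Re: "- y \<le> Re z"
  then have hz: "set_integrable lborel {0<..} (h (of_real y + z))"
      "(LBINT s:{0<..}. h (of_real y + z) s) = wt_stieltjes l a 1 (of_real y + z)"
    unfolding h_def using laplace_wt_laplace[OF l a, of "of_real y + z"] by auto
  have G: "wgm x y l z' = of_real y + z' + of_real (l * a)
      - of_real (sin (l * pi) / pi * a\<^sup>2) * wt_stieltjes l a 1 (of_real y + z')"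
    if "z' \<notin> complex_of_real ` {.. - y}" for z'
  proof -
    have "of_real y + z' \<notin> complex_of_real ` {..0}"
      using that unfolding slit_Im_Re by auto
    from powr_mean_eq_wt_stieltjes[OF l a this] show ?thesis
      by (simp add: wgm_def a_def add.commute)
  qed
  have "(LBINT s:{0<..}. wgm_integrand x y l z s)
      = (LBINT s:{0<..}. of_real a * (h (of_real y) s - h (of_real y + z) s))"
    by (intro set_lebesgue_integral_cong) (auto simp: eq)
  also have "\<dots> = of_real a * (wt_stieltjes l a 1 (of_real y) - wt_stieltjes l a 1 (of_real y + z))"
    by (simp add: set_integral_diff hy hz)
  finally have L: "(LBINT s:{0<..}. wgm_integrand x y l z s)
      = of_real a * (wt_stieltjes l a 1 (of_real y) - wt_stieltjes l a 1 (of_real y + z))" .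
  \<comment> \<open>Evaluating at \<open>z = 0\<close> supplies the constant term and eliminates
    \<open>y + l * a\<close> from the general formula.\<close>
  have "of_real (x powr l * y powr (1 - l)) = (wgm x y l 0 :: complex)"
    using powr_of_real[of x l] powr_of_real[of y "1 - l"] xy by (simp add: wgm_def)
  also have "\<dots> = of_real y + of_real (l * a)
      - of_real (sin (l * pi) / pi * a\<^sup>2) * wt_stieltjes l a 1 (of_real y)"
    using G[of 0] xy unfolding slit_Im_Re by simp
  finally show "wgm x y l z = of_real (x powr l * y powr (1 - l)) + z
      + of_real (sin (l * pi) / pi * (x - y)) * (LBINT s:{0<..}. wgm_integrand x y l z s)"
    unfolding L G[OF z] by (simp add: a_def[symmetric] power2_eq_square algebra_simps)
qed

text \<open>The integrand of \<open>F\<close> changes sign at \<open>u = 1 - l\<close>; after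
  integration by parts the weight is nonnegative, and \<open>wt_laplace_lower\<close> gives
  strictness.\<close>

lemma F_pos:
  assumes l: "0 < l" "l < 1" and s: "0 < s"
  shows "0 < F l s"
proof -
  obtain c where c: "0 < c" "c * exp (- (1 * s)) \<le> wt_laplace l s"
    using wt_laplace_lower[OF l, of 1] s by auto
  have "0 < c * exp (- (1 * s))" using c by simp
  also note c(2)
  finally show ?thesis using s by (simp add: F_eq_wt_laplace[OF l s])
qed

(* The integral diverges when Re z < - y (its integrand grows exponentially), so the
   representation is asserted at every z of the slit plane at which the integral exists, which
   includes every z with Re z >= - y; in the rest of the slit plane it holds in the sense of
   analytic continuation, G being holomorphic there. *)
theorem theorem3p2:
  fixes l x y :: real
  assumes "0 < l" "l < 1" "0 < x" "0 < y"
  shows "(y < x \<longrightarrow>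
            (\<forall>z. z \<notin> complex_of_real ` {.. - y} \<longrightarrow>
               (- y \<le> Re z \<longrightarrow> set_integrable lborel {0<..} (wgm_integrand x y l z)) \<and>
               (set_integrable lborel {0<..} (wgm_integrand x y l z) \<longrightarrow>
                  wgm x y l z =
                    of_real (x powr l * y powr (1 - l)) + z
                    + of_real (sin (l * pi) / pi * (x - y))
                      * (LBINT s:{0<..}. wgm_integrand x y l z s))) \<and>
            (wgm x y l :: complex \<Rightarrow> complex) holomorphic_on - complex_of_real ` {.. - y} \<and>
            (\<forall>s>0. set_integrable lborel {0<..<1} (F_integrand l s) \<and> 0 < F l s))
         \<and> bernstein_function_on {- min x y<..} (wgm x y l)"
  using wgm_integral_representation[OF assms(1,2,4)] wgm_holomorphic_on[of y x l]
    set_integrable_F_integrand[OF assms(1,2)] F_pos[OF assms(1,2)] bernstein_wgm[OF assms(1,2)]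
  by (auto simp del: of_real_mult of_real_divide)

end
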